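(* Let $A$ and $B$ be two measured sets with $\sharp A=\sharp B$. If $A\cap B\neq\emptyset$ and $A\neq B$, then $A\setminus(A\cap B)$ and $B\setminus(A\cap B)$ are nonempty. Moreover, if $A\cap B$ is co-measured in $A$ and in $B$, then both $A\setminus(A\cap B)$ and $B\setminus(A\cap B)$ are measured, and $\sharp\big(A\setminus(A\cap B)\big)=\sharp\big(B\setminus(A\cap B)\big)$.
   Context: We work in Sergeyev's numeral system, which contains the standard numerals for finite integers together with the symbol ① (grossone), defined as the number of elements of the set of natural numbers, with $n<$ ① for every finite positive integer $n$. Postulate 3 of this system: "the part is less than the whole" holds for all numbers and all sets, so a proper subset has strictly fewer elements. For a number $\mu$, $[1..\mu]$ denotes the set of integers $k$ with $1\le k\le\mu$. A measurement of a nonempty set $E$ in a numeral system $\mathcal S$ is a (described) bijection from $[1..\mu]$ onto $E$, where $\mu$ is a positive integer (finite or infinite, possibly larger than ①) expressible in $\mathcal S$; $E$ is then measured and $\sharp E=\mu$. A subset $A$ of $E$ is co-measured in $E$ if both $A$ and $E\setminus A$ are measured. *)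

theory Defs
  imports Main
begin

text \<open>
  The type \<open>'n\<close> carries the integers, finite and infinite; the finite ones are the values of
  \<^term>\<open>of_int\<close>. \<open>S\<close> is the set of integers expressible in the numeral system.
  In HOL an arbitrary function can map \<open>{1..\<mu>}\<close> bijectively onto a proper
  subset when \<open>\<mu>\<close> is infinite, so reading ``bijection'' as ``any HOL bijection'' would refute the
  part-whole postulate. Measurements therefore range over a set \<open>D\<close> of \<^emph>\<open>described\<close> maps. These are
  rules given by total functions, of which only the values on \<open>{1..\<mu>}\<close> matter in a measurement;
  in particular the same rule on a shorter segment is again described.
\<close>

definition measurement ::
    "'n::linordered_idom set \<Rightarrow> ('n \<Rightarrow> 'a) set \<Rightarrow> ('n \<Rightarrow> 'a) \<Rightarrow> 'n \<Rightarrow> 'a set \<Rightarrow> bool"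
  where "measurement S D f \<mu> E \<longleftrightarrow> f \<in> D \<and> \<mu> \<in> S \<and> 1 \<le> \<mu> \<and> bij_betw f {1..\<mu>} E"

definition measured :: "'n::linordered_idom set \<Rightarrow> ('n \<Rightarrow> 'a) set \<Rightarrow> 'a set \<Rightarrow> bool"
  where "measured S D E \<longleftrightarrow> (\<exists>f \<mu>. measurement S D f \<mu> E)"

definition sharp :: "'n::linordered_idom set \<Rightarrow> ('n \<Rightarrow> 'a) set \<Rightarrow> 'a set \<Rightarrow> 'n"
  where "sharp S D E = (THE \<mu>. \<exists>f. measurement S D f \<mu> E)"

definition co_measured :: "'n::linordered_idom set \<Rightarrow> ('n \<Rightarrow> 'a) set \<Rightarrow> 'a set \<Rightarrow> 'a set \<Rightarrow> bool"
  where "co_measured S D A E \<longleftrightarrow> A \<subseteq> E \<and> measured S D A \<and> measured S D (E - A)"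

definition append_map :: "'n::linordered_idom \<Rightarrow> ('n \<Rightarrow> 'a) \<Rightarrow> ('n \<Rightarrow> 'a) \<Rightarrow> 'n \<Rightarrow> 'a"
  where "append_map \<mu> f g = (\<lambda>k. if k \<le> \<mu> then f k else g (k - \<mu>))"

text \<open>
  \<open>G\<close> is grossone. The map \<open>num\<close> views integers as elements of the universe \<open>'a\<close> of sets, so that the
  set of natural numbers, which ends in grossone, is \<open>num ` {1..G}\<close>.
  The part-whole postulate for numbers is part of the ordered ring structure. For sets it is
  stated for any two measurements, because that the number of elements does not depend on the
  chosen measurement is a consequence of it (\<open>measurement_unique\<close> below).
  Assumption \<open>append\<close> only says that listing one described set after another, disjoint, one is again
  a description; no assumption is made about numbers of elements of unions or differences.
\<close>

locale grossone_system =
  fixes G :: "'n::linordered_idom"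
    and S :: "'n set"
    and D :: "('n \<Rightarrow> 'a) set"
    and num :: "'n \<Rightarrow> 'a"
  assumes discrete: "(0::'n) < k \<Longrightarrow> 1 \<le> k"
    and finite_less_grossone: "of_nat n < G"
    and finite_expressible: "of_int i \<in> S"
    and grossone_expressible: "G \<in> S"
    and add_expressible: "\<lbrakk>\<mu> \<in> S; \<nu> \<in> S\<rbrakk> \<Longrightarrow> \<mu> + \<nu> \<in> S"
    and naturals_measured: "measurement S D num G (num ` {1..G})"
    and append: "\<lbrakk>measurement S D f \<mu> A; measurement S D g \<nu> B; A \<inter> B = {}\<rbrakk>
                  \<Longrightarrow> append_map \<mu> f g \<in> D"
    and part_less_whole: "\<lbrakk>measurement S D f \<mu> A; measurement S D g \<nu> B; A \<subset> B\<rbrakk> \<Longrightarrow> \<mu> < \<nu>"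
begin

lemma measurement_le:
  assumes f: "measurement S D f \<mu> E" and g: "measurement S D g \<nu> E"
  shows "\<nu> \<le> \<mu>"
proof (rule ccontr)
  assume "\<not> \<nu> \<le> \<mu>"
  hence lt: "\<mu> < \<nu>" by simp
  have inj: "inj_on g {1..\<nu>}" and E: "g ` {1..\<nu>} = E" and "1 \<le> \<nu>"
    using g by (auto simp: measurement_def bij_betw_def)
  have sub: "{1..\<mu>} \<subseteq> {1..\<nu>}" using lt by auto
  have init: "measurement S D g \<mu> (g ` {1..\<mu>})"
    using f g inj_on_subset[OF inj sub] by (auto simp: measurement_def bij_betw_def)
  have "g \<nu> \<notin> g ` {1..\<mu>}"
    using inj lt sub \<open>1 \<le> \<nu>\<close> by (auto dest!: inj_onD)
  moreover have "g \<nu> \<in> E" using E \<open>1 \<le> \<nu>\<close> by auto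
  ultimately have "g ` {1..\<mu>} \<subset> E" using E sub by blast
  from part_less_whole[OF init f this] show False by simp
qed

lemma measurement_unique:
  "\<lbrakk>measurement S D f \<mu> E; measurement S D g \<nu> E\<rbrakk> \<Longrightarrow> \<mu> = \<nu>"
  using measurement_le by (meson order_antisym)

lemma sharp_eq: "measurement S D f \<mu> E \<Longrightarrow> sharp S D E = \<mu>"
  unfolding sharp_def using measurement_unique by blast

lemma sharp_naturals: "sharp S D (num ` {1..G}) = G"
  using naturals_measured by (rule sharp_eq)

end

end

theory Submission imports Defs begin

text \<open>The part-whole postulate makes \<open>sharp\<close> strictly monotone on measured sets
  (\<open>sharp_strict_mono\<close>), so neither of two measured sets with equal
  \<open>sharp\<close> lies properly inside the other; as they differ, neither is a subset of the
  other. For the equality, listing one set after a disjoint one measures the union by the sum of the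
  lengths (\<open>measurement_disjoint_union\<close>). Since the length of a measurement is unique,
  removing a co-measured part subtracts its number (\<open>sharp_Diff_co_measured\<close>), and here
  the same number is subtracted from equal ones.\<close>

context grossone_system
begin

text \<open>The segment of length \<open>\<mu> + \<nu>\<close> is cut after \<open>\<mu>\<close>;
  its upper piece, shifted down by \<open>\<mu>\<close>, becomes the domain of
  \<open>g\<close>.\<close>

lemma bij_betw_append_map:
  fixes f g :: "'n \<Rightarrow> 'a"
  assumes f: "bij_betw f {1..\<mu>} A" and g: "bij_betw g {1..\<nu>} B"
    and disj: "A \<inter> B = {}" and "1 \<le> \<mu>" and "1 \<le> \<nu>"
  shows "bij_betw (append_map \<mu> f g) {1..\<mu> + \<nu>} (A \<union> B)"
proof -
  have left: "bij_betw (append_map \<mu> f g) {1..\<mu>} A"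
    using f by (rule bij_betw_cong[THEN iffD1, rotated]) (simp add: append_map_def)
  have shift: "bij_betw (\<lambda>k. k - \<mu>) {\<mu> + 1..\<mu> + \<nu>} {1..\<nu>}"
    by (rule bij_betw_byWitness[where f' = "\<lambda>k. k + \<mu>"]) (auto simp: algebra_simps)
  have "bij_betw (\<lambda>k. g (k - \<mu>)) {\<mu> + 1..\<mu> + \<nu>} B"
    using bij_betw_trans[OF shift g] by (simp add: o_def)
  moreover have "\<not> k \<le> \<mu>" if "k \<in> {\<mu> + 1..\<mu> + \<nu>}" for k
    using that less_le_trans[of \<mu> "\<mu> + 1" k] by simp
  ultimately have right: "bij_betw (append_map \<mu> f g) {\<mu> + 1..\<mu> + \<nu>} B"
    by (subst bij_betw_cong[where g = "\<lambda>k. g (k - \<mu>)"]) (auto simp: append_map_def)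
  \<comment> \<open>Discreteness leaves nothing strictly between \<open>\<mu>\<close> and
    \<open>\<mu> + 1\<close>, so the two segments cover the whole one.\<close>
  have "\<mu> + 1 \<le> k" if "\<not> k \<le> \<mu>" for k
    using discrete[of "k - \<mu>"] that by (simp add: algebra_simps)
  moreover have "\<mu> \<le> \<mu> + \<nu>" and "1 \<le> \<mu> + 1"
    using \<open>1 \<le> \<mu>\<close> \<open>1 \<le> \<nu>\<close> by (simp_all add: order_trans[OF zero_le_one])
  ultimately have "{1..\<mu> + \<nu>} = {1..\<mu>} \<union> {\<mu> + 1..\<mu> + \<nu>}"
    by (force intro: order_trans)
  with bij_betw_combine[OF left right disj] show ?thesis by simp
qed

lemma measurement_disjoint_union:
  assumes f: "measurement S D f \<mu> A" and g: "measurement S D g \<nu> B" and disj: "A \<inter> B = {}"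
  shows "measurement S D (append_map \<mu> f g) (\<mu> + \<nu>) (A \<union> B)"
proof -
  have "1 \<le> \<mu>" and "1 \<le> \<nu>" using f g by (auto simp: measurement_def)
  hence "1 \<le> \<mu> + \<nu>" using add_mono[of 1 \<mu> 0 \<nu>] order_trans[OF zero_le_one] by simp
  with f g disj show ?thesis
    using append[OF f g disj] add_expressible bij_betw_append_map
    by (auto simp: measurement_def)
qed

text \<open>Uniqueness of the length makes the definite description in \<open>sharp\<close> the
  length of an actual measurement.\<close>

lemma measured_measurement_sharp:
  assumes "measured S D E"
  obtains f where "measurement S D f (sharp S D E) E"
  using assms sharp_eq unfolding measured_def by blast

lemma sharp_strict_mono:
  "\<lbrakk>measured S D A; measured S D B; A \<subset> B\<rbrakk> \<Longrightarrow> sharp S D A < sharp S D B"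
  by (meson measured_measurement_sharp part_less_whole)

lemma sharp_Diff_co_measured:
  assumes "co_measured S D C E"
  shows "sharp S D (E - C) = sharp S D E - sharp S D C"
proof -
  have "C \<subseteq> E" and "measured S D C" and "measured S D (E - C)"
    using assms by (auto simp: co_measured_def)
  then obtain f g where f: "measurement S D f (sharp S D C) C"
    and g: "measurement S D g (sharp S D (E - C)) (E - C)"
    by (meson measured_measurement_sharp)
  \<comment> \<open>The concatenated listing is itself a measurement of
    \<open>C \<union> (E - C) = E\<close>, so its length is \<open>sharp S D E\<close>.\<close>
  have "sharp S D E = sharp S D C + sharp S D (E - C)"
    using sharp_eq[OF measurement_disjoint_union[OF f g]] \<open>C \<subseteq> E\<close>
    by (simp add: Un_absorb1)
  thus ?thesis by simp
qed

end

theorem theorem4: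
  fixes G :: "'n::linordered_idom"
    and S :: "'n set"
    and D :: "('n \<Rightarrow> 'a) set"
    and num :: "'n \<Rightarrow> 'a"
    and A B :: "'a set"
  assumes "grossone_system G S D num"
    and "measured S D A" and "measured S D B"
    and "sharp S D A = sharp S D B"
    and "A \<inter> B \<noteq> {}" and "A \<noteq> B"
  shows "A - (A \<inter> B) \<noteq> {} \<and> B - (A \<inter> B) \<noteq> {} \<and>
    (co_measured S D (A \<inter> B) A \<and> co_measured S D (A \<inter> B) B \<longrightarrow>
      measured S D (A - (A \<inter> B)) \<and> measured S D (B - (A \<inter> B)) \<and>
      sharp S D (A - (A \<inter> B)) = sharp S D (B - (A \<inter> B)))"
proof -
  interpret grossone_system G S D num by fact
  have "\<not> A \<subset> B" and "\<not> B \<subset> A"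
    using sharp_strict_mono assms(2-4) by (metis less_irrefl)+
  moreover have "sharp S D (A - (A \<inter> B)) = sharp S D (B - (A \<inter> B))"
    if "co_measured S D (A \<inter> B) A" and "co_measured S D (A \<inter> B) B"
    using that assms(4) by (simp only: sharp_Diff_co_measured)
  \<comment> \<open>An empty difference would mean an inclusion, proper because
    \<open>A \<noteq> B\<close>. That the differences are measured is part of
    \<open>co_measured\<close>.\<close>
  ultimately show ?thesis
    using \<open>A \<noteq> B\<close> unfolding co_measured_def by blast
qed

end
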